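(* Let $R$ be an associative ring with identity. If every simple singular right $R$-module is ss-injective, then for every $a\in S_r\cap J$ the right annihilator $r(a)$ is a direct summand of $R_R$, and $S_r$ is projective as a right $R$-module.
   Context: All modules are unitary. $S_r=\mathrm{soc}(R_R)$ is the right socle of $R$, $J$ is the Jacobson radical of $R$, and $r(a)=\{x\in R: ax=0\}$. A right module $M$ is singular if the annihilator in $R$ of each of its elements is an essential right ideal. A submodule $K$ of $N$ is small if $K+L\neq N$ for every proper submodule $L$ of $N$. A right $R$-module $M$ is ss-injective if for every right ideal $K$ of $R$ that is semisimple and small in $R_R$, every $R$-homomorphism $K\to M$ extends to an $R$-homomorphism $R_R\to M$. *)

theory Defs
  imports "HOL-Algebra.AbelCoset"
begin

text \<open>
  \<^locale>\<open>ring\<close> of HOL-Algebra is an associative, not necessarily commutative, ring with identity.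
  The library's modules are left modules over commutative rings, so unitary right modules are set
  up here. As with the library's record of modules, the fields \<^term>\<open>monoid.mult\<close> and
  \<^term>\<open>monoid.one\<close> inherited by the record below carry no meaning.
\<close>

record ('a, 'm) rmodule = "'m ring" +
  ract :: "['m, 'a] \<Rightarrow> 'm" (infixl \<open>\<cdot>\<index>\<close> 70)

locale right_module = R?: ring R + M?: abelian_group M
  for R (structure) and M (structure) +
  assumes ract_closed:
      "\<lbrakk>x \<in> carrier M; r \<in> carrier R\<rbrakk> \<Longrightarrow> x \<cdot>\<^bsub>M\<^esub> r \<in> carrier M"
    and ract_l_distr:
      "\<lbrakk>x \<in> carrier M; y \<in> carrier M; r \<in> carrier R\<rbrakk> \<Longrightarrow>
        (x \<oplus>\<^bsub>M\<^esub> y) \<cdot>\<^bsub>M\<^esub> r = x \<cdot>\<^bsub>M\<^esub> r \<oplus>\<^bsub>M\<^esub> y \<cdot>\<^bsub>M\<^esub> r"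
    and ract_r_distr:
      "\<lbrakk>x \<in> carrier M; r \<in> carrier R; s \<in> carrier R\<rbrakk> \<Longrightarrow>
        x \<cdot>\<^bsub>M\<^esub> (r \<oplus> s) = x \<cdot>\<^bsub>M\<^esub> r \<oplus>\<^bsub>M\<^esub> x \<cdot>\<^bsub>M\<^esub> s"
    and ract_assoc:
      "\<lbrakk>x \<in> carrier M; r \<in> carrier R; s \<in> carrier R\<rbrakk> \<Longrightarrow>
        x \<cdot>\<^bsub>M\<^esub> (r \<otimes> s) = (x \<cdot>\<^bsub>M\<^esub> r) \<cdot>\<^bsub>M\<^esub> s"
    and ract_one:
      "x \<in> carrier M \<Longrightarrow> x \<cdot>\<^bsub>M\<^esub> \<one> = x"

definition regular_rmodule :: "('a, 'b) ring_scheme \<Rightarrow> ('a, 'a) rmodule" where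
  "regular_rmodule R =
    \<lparr>carrier = carrier R, monoid.mult = monoid.mult R, one = one R, zero = zero R, add = add R,
     ract = monoid.mult R\<rparr>"

definition rsubmodule ::
  "('a, 'b) ring_scheme \<Rightarrow> ('a, 'm, 'c) rmodule_scheme \<Rightarrow> 'm set \<Rightarrow> bool" where
  "rsubmodule R M N \<longleftrightarrow>
    additive_subgroup N M \<and> (\<forall>x\<in>N. \<forall>r\<in>carrier R. x \<cdot>\<^bsub>M\<^esub> r \<in> N)"

text \<open>A submodule \<open>N\<close> of \<open>M\<close>, regarded as a module, is \<open>M\<lparr>carrier := N\<rparr>\<close>.\<close>

abbreviation right_ideal :: "('a, 'b) ring_scheme \<Rightarrow> 'a set \<Rightarrow> bool" where
  "right_ideal R \<equiv> rsubmodule R (regular_rmodule R)"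

definition rmodule_hom ::
  "('a, 'b) ring_scheme \<Rightarrow> ('a, 'm, 'c) rmodule_scheme \<Rightarrow> ('a, 'n, 'd) rmodule_scheme
    \<Rightarrow> ('m \<Rightarrow> 'n) set" where
  "rmodule_hom R M N =
    {f \<in> hom (add_monoid M) (add_monoid N).
      \<forall>x\<in>carrier M. \<forall>r\<in>carrier R. f (x \<cdot>\<^bsub>M\<^esub> r) = f x \<cdot>\<^bsub>N\<^esub> r}"

definition simple_rmodule ::
  "('a, 'b) ring_scheme \<Rightarrow> ('a, 'm, 'c) rmodule_scheme \<Rightarrow> bool" where
  "simple_rmodule R M \<longleftrightarrow>
    right_module R M \<and> carrier M \<noteq> {\<zero>\<^bsub>M\<^esub>} \<and>
    (\<forall>N. rsubmodule R M N \<longrightarrow> N = {\<zero>\<^bsub>M\<^esub>} \<or> N = carrier M)"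

text \<open>The socle is the sum of all simple submodules, i.e. the least submodule containing them all.\<close>

definition socle ::
  "('a, 'b) ring_scheme \<Rightarrow> ('a, 'm, 'c) rmodule_scheme \<Rightarrow> 'm set" where
  "socle R M =
    \<Inter> {N. rsubmodule R M N \<and>
       (\<forall>S. rsubmodule R M S \<and> simple_rmodule R (M\<lparr>carrier := S\<rparr>) \<longrightarrow> S \<subseteq> N)}"

definition right_socle :: "('a, 'b) ring_scheme \<Rightarrow> 'a set" where
  "right_socle R = socle R (regular_rmodule R)"

definition semisimple_rmodule ::
  "('a, 'b) ring_scheme \<Rightarrow> ('a, 'm, 'c) rmodule_scheme \<Rightarrow> bool" where
  "semisimple_rmodule R M \<longleftrightarrow> right_module R M \<and> socle R M = carrier M"

definition maximal_right_ideal :: "('a, 'b) ring_scheme \<Rightarrow> 'a set \<Rightarrow> bool" where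
  "maximal_right_ideal R I \<longleftrightarrow>
    right_ideal R I \<and> I \<noteq> carrier R \<and>
    (\<forall>K. right_ideal R K \<and> I \<subseteq> K \<longrightarrow> K = I \<or> K = carrier R)"

text \<open>The intersection with the carrier matters only for the zero ring, which equals its radical.\<close>

definition jacobson_radical :: "('a, 'b) ring_scheme \<Rightarrow> 'a set" where
  "jacobson_radical R = carrier R \<inter> \<Inter> {I. maximal_right_ideal R I}"

definition small_submodule ::
  "('a, 'b) ring_scheme \<Rightarrow> ('a, 'm, 'c) rmodule_scheme \<Rightarrow> 'm set \<Rightarrow> bool" where
  "small_submodule R N K \<longleftrightarrow>
    rsubmodule R N K \<and>
    (\<forall>L. rsubmodule R N L \<and> L \<noteq> carrier N \<longrightarrow> K <+>\<^bsub>N\<^esub> L \<noteq> carrier N)"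

definition essential_submodule ::
  "('a, 'b) ring_scheme \<Rightarrow> ('a, 'm, 'c) rmodule_scheme \<Rightarrow> 'm set \<Rightarrow> bool" where
  "essential_submodule R M K \<longleftrightarrow>
    rsubmodule R M K \<and>
    (\<forall>L. rsubmodule R M L \<and> L \<noteq> {\<zero>\<^bsub>M\<^esub>} \<longrightarrow> K \<inter> L \<noteq> {\<zero>\<^bsub>M\<^esub>})"

definition direct_summand ::
  "('a, 'b) ring_scheme \<Rightarrow> ('a, 'm, 'c) rmodule_scheme \<Rightarrow> 'm set \<Rightarrow> bool" where
  "direct_summand R M K \<longleftrightarrow>
    rsubmodule R M K \<and>
    (\<exists>L. rsubmodule R M L \<and> K \<inter> L = {\<zero>\<^bsub>M\<^esub>} \<and> K <+>\<^bsub>M\<^esub> L = carrier M)"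

definition annihilator ::
  "('a, 'b) ring_scheme \<Rightarrow> ('a, 'm, 'c) rmodule_scheme \<Rightarrow> 'm \<Rightarrow> 'a set" where
  "annihilator R M m = {r \<in> carrier R. m \<cdot>\<^bsub>M\<^esub> r = \<zero>\<^bsub>M\<^esub>}"

definition right_annihilator :: "('a, 'b) ring_scheme \<Rightarrow> 'a \<Rightarrow> 'a set" where
  "right_annihilator R a = {x \<in> carrier R. a \<otimes>\<^bsub>R\<^esub> x = \<zero>\<^bsub>R\<^esub>}"

definition singular_rmodule ::
  "('a, 'b) ring_scheme \<Rightarrow> ('a, 'm, 'c) rmodule_scheme \<Rightarrow> bool" where
  "singular_rmodule R M \<longleftrightarrow>
    right_module R M \<and>
    (\<forall>m\<in>carrier M. essential_submodule R (regular_rmodule R) (annihilator R M m))"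

definition ss_injective ::
  "('a, 'b) ring_scheme \<Rightarrow> ('a, 'm, 'c) rmodule_scheme \<Rightarrow> bool" where
  "ss_injective R M \<longleftrightarrow>
    right_module R M \<and>
    (\<forall>K. right_ideal R K \<and>
         semisimple_rmodule R ((regular_rmodule R)\<lparr>carrier := K\<rparr>) \<and>
         small_submodule R (regular_rmodule R) K \<longrightarrow>
      (\<forall>f \<in> rmodule_hom R ((regular_rmodule R)\<lparr>carrier := K\<rparr>) M.
        \<exists>g \<in> rmodule_hom R (regular_rmodule R) M. \<forall>x\<in>K. g x = f x))"

text \<open>
  Projectivity as the lifting property against all epimorphisms \<open>A \<rightarrow> B\<close>. A definition cannot
  quantify over types, so the types of the elements of \<open>A\<close> and \<open>B\<close> are parameters; a theorem
  concluding projectivity for type variables \<open>'m\<close> and \<open>'n\<close> that occur nowhere else asserts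
  lifting against all epimorphisms of right modules, without any bound on their size.
\<close>

definition projective_rmodule ::
  "'m itself \<Rightarrow> 'n itself \<Rightarrow> ('a, 'b) ring_scheme \<Rightarrow> ('a, 'p, 'c) rmodule_scheme \<Rightarrow> bool" where
  "projective_rmodule _ _ R P \<longleftrightarrow>
    right_module R P \<and>
    (\<forall>(A :: ('a, 'm) rmodule) (B :: ('a, 'n) rmodule).
      right_module R A \<and> right_module R B \<longrightarrow>
      (\<forall>g \<in> rmodule_hom R A B. g ` carrier A = carrier B \<longrightarrow>
        (\<forall>f \<in> rmodule_hom R P B. \<exists>h \<in> rmodule_hom R P A. \<forall>x\<in>carrier P. g (h x) = f x)))"

text \<open>
  In a hypothesis, \<open>every simple singular right module\<close> has to range over modules with elements
  of one fixed type. The type \<open>'a set\<close>, where \<open>'a\<close> is the type of ring elements, loses nothing: a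
  simple module with a nonzero element \<open>m\<close> embeds into it by sending \<open>x\<close> to the coset
  \<open>{r. m r = x}\<close> of the annihilator of \<open>m\<close>. The rest of this theory proves this.
\<close>

lemma rsubmoduleD:
  assumes "rsubmodule R N K"
  shows "K \<subseteq> carrier N" "\<zero>\<^bsub>N\<^esub> \<in> K" "\<And>x y. \<lbrakk>x \<in> K; y \<in> K\<rbrakk> \<Longrightarrow> x \<oplus>\<^bsub>N\<^esub> y \<in> K"
    "\<And>x r. \<lbrakk>x \<in> K; r \<in> carrier R\<rbrakk> \<Longrightarrow> x \<cdot>\<^bsub>N\<^esub> r \<in> K"
proof -
  have "subgroup K (add_monoid N)" and act: "\<forall>x\<in>K. \<forall>r\<in>carrier R. x \<cdot>\<^bsub>N\<^esub> r \<in> K"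
    using assms by (simp_all add: rsubmodule_def additive_subgroup_def)
  from subgroup.subset[OF this(1)] subgroup.one_closed[OF this(1)] subgroup.m_closed[OF this(1)] act
  show "K \<subseteq> carrier N" "\<zero>\<^bsub>N\<^esub> \<in> K" "\<And>x y. \<lbrakk>x \<in> K; y \<in> K\<rbrakk> \<Longrightarrow> x \<oplus>\<^bsub>N\<^esub> y \<in> K"
    "\<And>x r. \<lbrakk>x \<in> K; r \<in> carrier R\<rbrakk> \<Longrightarrow> x \<cdot>\<^bsub>N\<^esub> r \<in> K"
    by auto
qed

lemma (in right_module) rsubmoduleI:
  assumes "K \<subseteq> carrier M" "\<zero>\<^bsub>M\<^esub> \<in> K" "\<And>x y. \<lbrakk>x \<in> K; y \<in> K\<rbrakk> \<Longrightarrow> x \<oplus>\<^bsub>M\<^esub> y \<in> K"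
    "\<And>x r. \<lbrakk>x \<in> K; r \<in> carrier R\<rbrakk> \<Longrightarrow> x \<cdot>\<^bsub>M\<^esub> r \<in> K"
  shows "rsubmodule R M K"
proof -
  have "\<ominus>\<^bsub>M\<^esub> x \<in> K" if "x \<in> K" for x
  proof -
    have x: "x \<in> carrier M" using that assms by blast
    have "x \<cdot>\<^bsub>M\<^esub> (\<one>\<^bsub>R\<^esub> \<oplus>\<^bsub>R\<^esub> \<ominus>\<^bsub>R\<^esub> \<one>\<^bsub>R\<^esub>) = x \<oplus>\<^bsub>M\<^esub> x \<cdot>\<^bsub>M\<^esub> (\<ominus>\<^bsub>R\<^esub> \<one>\<^bsub>R\<^esub>)"
      using x by (simp add: ract_r_distr ract_one del: R.r_neg)
    moreover have "x \<cdot>\<^bsub>M\<^esub> \<zero>\<^bsub>R\<^esub> = \<zero>\<^bsub>M\<^esub>"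
    proof -
      have "x \<cdot>\<^bsub>M\<^esub> (\<zero>\<^bsub>R\<^esub> \<oplus>\<^bsub>R\<^esub> \<zero>\<^bsub>R\<^esub>) = x \<cdot>\<^bsub>M\<^esub> \<zero>\<^bsub>R\<^esub> \<oplus>\<^bsub>M\<^esub> x \<cdot>\<^bsub>M\<^esub> \<zero>\<^bsub>R\<^esub>"
        using x by (intro ract_r_distr) auto
      then show ?thesis using x ract_closed[of x "\<zero>\<^bsub>R\<^esub>"] by simp
    qed
    ultimately have "x \<oplus>\<^bsub>M\<^esub> x \<cdot>\<^bsub>M\<^esub> (\<ominus>\<^bsub>R\<^esub> \<one>\<^bsub>R\<^esub>) = \<zero>\<^bsub>M\<^esub>" by (simp add: R.r_neg)
    then have "\<ominus>\<^bsub>M\<^esub> x = x \<cdot>\<^bsub>M\<^esub> (\<ominus>\<^bsub>R\<^esub> \<one>\<^bsub>R\<^esub>)"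
      using x by (intro M.minus_equality) (auto simp: M.a_comm ract_closed)
    then show ?thesis using that assms(4) by simp
  qed
  then have "subgroup K (add_monoid M)"
    using assms(1-3) by (intro M.add.subgroupI) (auto simp: a_inv_def[symmetric])
  then show ?thesis using assms(4) by (simp add: rsubmodule_def additive_subgroup_def)
qed

definition transport_rmodule ::
  "('m \<Rightarrow> 'n) \<Rightarrow> ('a, 'm, 'c) rmodule_scheme \<Rightarrow> ('a, 'n) rmodule" where
  "transport_rmodule p M = (let q = the_inv_into (carrier M) p in
    \<lparr>carrier = p ` carrier M, monoid.mult = undefined, one = undefined, zero = p \<zero>\<^bsub>M\<^esub>,
     add = (\<lambda>x y. p (q x \<oplus>\<^bsub>M\<^esub> q y)), ract = (\<lambda>x r. p (q x \<cdot>\<^bsub>M\<^esub> r))\<rparr>)"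

context
  fixes p :: "'m \<Rightarrow> 'n" and R :: "('a, 'b) ring_scheme" and M :: "('a, 'm, 'c) rmodule_scheme"
  assumes inj: "inj_on p (carrier M)" and mod: "right_module R M"
begin

interpretation right_module R M by (rule mod)

private abbreviation (input) "T \<equiv> transport_rmodule p M"

private lemma T_simps:
  "carrier T = p ` carrier M" "\<zero>\<^bsub>T\<^esub> = p \<zero>\<^bsub>M\<^esub>"
  "\<lbrakk>x \<in> carrier M; y \<in> carrier M\<rbrakk> \<Longrightarrow> p x \<oplus>\<^bsub>T\<^esub> p y = p (x \<oplus>\<^bsub>M\<^esub> y)"
  "x \<in> carrier M \<Longrightarrow> p x \<cdot>\<^bsub>T\<^esub> r = p (x \<cdot>\<^bsub>M\<^esub> r)"
  by (simp_all add: transport_rmodule_def Let_def the_inv_into_f_f[OF inj])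

private lemma right_module_T: "right_module R T"
proof -
  have "abelian_group T"
  proof (rule abelian_groupI)
    fix x assume "x \<in> carrier T"
    then obtain u where u: "u \<in> carrier M" "x = p u" by (auto simp: T_simps)
    then have "p (\<ominus>\<^bsub>M\<^esub> u) \<in> carrier T" "p (\<ominus>\<^bsub>M\<^esub> u) \<oplus>\<^bsub>T\<^esub> x = \<zero>\<^bsub>T\<^esub>"
      by (auto simp: T_simps M.l_neg)
    then show "\<exists>y\<in>carrier T. y \<oplus>\<^bsub>T\<^esub> x = \<zero>\<^bsub>T\<^esub>" by blast
  qed (auto simp: T_simps M.a_ac)
  then show ?thesis
    by (intro right_module.intro right_module_axioms.intro R.ring_axioms)
       (auto simp: T_simps ract_closed ract_l_distr ract_r_distr ract_assoc ract_one)
qed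

private lemma annihilator_T: "x \<in> carrier M \<Longrightarrow> annihilator R T (p x) = annihilator R M x"
  using inj by (auto simp: annihilator_def T_simps ract_closed dest!: inj_onD)

private lemma simple_T:
  assumes "simple_rmodule R M"
  shows "simple_rmodule R T"
  unfolding simple_rmodule_def
proof (intro conjI allI impI)
  show "carrier T \<noteq> {\<zero>\<^bsub>T\<^esub>}"
  proof
    assume "carrier T = {\<zero>\<^bsub>T\<^esub>}"
    then have "p ` carrier M = p ` {\<zero>\<^bsub>M\<^esub>}" by (simp only: T_simps image_insert image_empty)
    then have "carrier M = {\<zero>\<^bsub>M\<^esub>}" using inj_on_image_eq_iff[OF inj, of "carrier M" "{\<zero>\<^bsub>M\<^esub>}"] by simp
    then show False using assms by (simp add: simple_rmodule_def)
  qed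
  fix N assume N: "rsubmodule R T N"
  let ?K = "{x \<in> carrier M. p x \<in> N}"
  have "rsubmodule R M ?K"
  proof (rule rsubmoduleI)
    fix x y assume "x \<in> ?K" "y \<in> ?K"
    then show "x \<oplus>\<^bsub>M\<^esub> y \<in> ?K" using rsubmoduleD(3)[OF N, of "p x" "p y"] by (simp add: T_simps)
  next
    fix x r assume "x \<in> ?K" "r \<in> carrier R"
    then show "x \<cdot>\<^bsub>M\<^esub> r \<in> ?K"
      using rsubmoduleD(4)[OF N, of "p x" r] by (simp add: T_simps ract_closed)
  qed (use rsubmoduleD(2)[OF N] in \<open>auto simp: T_simps\<close>)
  then have "?K = {\<zero>\<^bsub>M\<^esub>} \<or> ?K = carrier M" using assms by (simp only: simple_rmodule_def)
  then have "p ` ?K = {\<zero>\<^bsub>T\<^esub>} \<or> p ` ?K = carrier T"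
    by (elim disjE) (simp_all only: T_simps image_insert image_empty simp_thms)
  moreover have "N = p ` ?K" using rsubmoduleD(1)[OF N] by (auto simp: T_simps)
  ultimately show "N = {\<zero>\<^bsub>T\<^esub>} \<or> N = carrier T" by (simp only:)
qed (rule right_module_T)

private lemma ss_injective_T:
  assumes "ss_injective R T"
  shows "ss_injective R M"
  unfolding ss_injective_def
proof (intro conjI allI impI ballI)
  fix K f
  let ?K = "(regular_rmodule R)\<lparr>carrier := K\<rparr>" and ?q = "the_inv_into (carrier M) p"
  assume K: "right_ideal R K \<and> semisimple_rmodule R ?K \<and> small_submodule R (regular_rmodule R) K"
    and f: "f \<in> rmodule_hom R ?K M"
  have fM: "f x \<in> carrier M" if "x \<in> K" for x
    using f that by (auto simp: rmodule_hom_def hom_def)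
  have "p \<circ> f \<in> rmodule_hom R ?K T"
    using f fM by (auto simp: rmodule_hom_def hom_def T_simps)
  then obtain g where g: "g \<in> rmodule_hom R (regular_rmodule R) T" "\<forall>x\<in>K. g x = (p \<circ> f) x"
    using assms K unfolding ss_injective_def by blast
  have q: "\<exists>u\<in>carrier M. g x = p u \<and> ?q (g x) = u" if "x \<in> carrier R" for x
  proof -
    have "g x \<in> p ` carrier M"
      using g(1) that by (auto simp: rmodule_hom_def hom_def T_simps regular_rmodule_def)
    then show ?thesis using the_inv_into_f_f[OF inj] by auto
  qed
  have "?q \<circ> g \<in> rmodule_hom R (regular_rmodule R) M"
  proof -
    have "?q (g x) \<in> carrier M" if "x \<in> carrier R" for x using q[OF that] by auto
    moreover have "?q (g (x \<oplus>\<^bsub>R\<^esub> y)) = ?q (g x) \<oplus>\<^bsub>M\<^esub> ?q (g y)"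
      if x: "x \<in> carrier R" and y: "y \<in> carrier R" for x y
    proof -
      have "g (x \<oplus>\<^bsub>R\<^esub> y) = g x \<oplus>\<^bsub>T\<^esub> g y"
        using g(1) x y by (auto simp: rmodule_hom_def hom_def regular_rmodule_def)
      moreover from q[OF x] q[OF y]
      obtain u v where "u \<in> carrier M" "g x = p u" "v \<in> carrier M" "g y = p v"
        by (elim bexE conjE)
      ultimately show ?thesis by (simp add: T_simps the_inv_into_f_f[OF inj])
    qed
    moreover have "?q (g (x \<otimes>\<^bsub>R\<^esub> r)) = ?q (g x) \<cdot>\<^bsub>M\<^esub> r"
      if x: "x \<in> carrier R" and r: "r \<in> carrier R" for x r
    proof -
      have "g (x \<otimes>\<^bsub>R\<^esub> r) = g x \<cdot>\<^bsub>T\<^esub> r"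
        using g(1) x r by (auto simp: rmodule_hom_def regular_rmodule_def)
      moreover from q[OF x] obtain u where "u \<in> carrier M" "g x = p u" by (elim bexE conjE)
      ultimately show ?thesis using r by (simp add: T_simps ract_closed the_inv_into_f_f[OF inj])
    qed
    ultimately show ?thesis by (auto simp: rmodule_hom_def hom_def regular_rmodule_def)
  qed
  moreover have "\<forall>x\<in>K. (?q \<circ> g) x = f x" using g(2) fM by (simp add: the_inv_into_f_f[OF inj])
  ultimately show "\<exists>h\<in>rmodule_hom R (regular_rmodule R) M. \<forall>x\<in>K. h x = f x" by blast
qed (rule mod)

lemmas transport_facts =
  right_module_T annihilator_T simple_T ss_injective_T

end

lemma simple_singular_ss_injective_any_type:
  fixes R :: "('a, 'b) ring_scheme" and M :: "('a, 'm, 'c) rmodule_scheme"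
  assumes all: "\<And>N :: ('a, 'a set) rmodule.
      simple_rmodule R N \<Longrightarrow> singular_rmodule R N \<Longrightarrow> ss_injective R N"
    and simple: "simple_rmodule R M" and sing: "singular_rmodule R M"
  shows "ss_injective R M"
proof -
  have mod: "right_module R M" using simple by (simp add: simple_rmodule_def)
  interpret right_module R M by (rule mod)
  obtain m where m: "m \<in> carrier M" "m \<noteq> \<zero>\<^bsub>M\<^esub>"
    using simple M.zero_closed unfolding simple_rmodule_def by blast
  let ?N = "{m \<cdot>\<^bsub>M\<^esub> r |r. r \<in> carrier R}"
  have "rsubmodule R M ?N"
  proof (rule rsubmoduleI)
    have "m \<cdot>\<^bsub>M\<^esub> (\<zero>\<^bsub>R\<^esub> \<oplus>\<^bsub>R\<^esub> \<zero>\<^bsub>R\<^esub>) = m \<cdot>\<^bsub>M\<^esub> \<zero>\<^bsub>R\<^esub> \<oplus>\<^bsub>M\<^esub> m \<cdot>\<^bsub>M\<^esub> \<zero>\<^bsub>R\<^esub>"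
      using m by (intro ract_r_distr) auto
    then have "m \<cdot>\<^bsub>M\<^esub> \<zero>\<^bsub>R\<^esub> = \<zero>\<^bsub>M\<^esub>" using m ract_closed[of m "\<zero>\<^bsub>R\<^esub>"] by simp
    from this[symmetric] show "\<zero>\<^bsub>M\<^esub> \<in> ?N" using R.zero_closed by blast
  next
    fix x y assume "x \<in> ?N" "y \<in> ?N"
    then obtain r s where "r \<in> carrier R" "s \<in> carrier R" "x = m \<cdot>\<^bsub>M\<^esub> r" "y = m \<cdot>\<^bsub>M\<^esub> s"
      by blast
    then have "r \<oplus>\<^bsub>R\<^esub> s \<in> carrier R \<and> x \<oplus>\<^bsub>M\<^esub> y = m \<cdot>\<^bsub>M\<^esub> (r \<oplus>\<^bsub>R\<^esub> s)"
      using m by (simp add: ract_r_distr)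
    then show "x \<oplus>\<^bsub>M\<^esub> y \<in> ?N" by blast
  next
    fix x r assume "x \<in> ?N" and r: "r \<in> carrier R"
    then obtain s where s: "s \<in> carrier R" "x = m \<cdot>\<^bsub>M\<^esub> s" by blast
    then have "s \<otimes>\<^bsub>R\<^esub> r \<in> carrier R \<and> x \<cdot>\<^bsub>M\<^esub> r = m \<cdot>\<^bsub>M\<^esub> (s \<otimes>\<^bsub>R\<^esub> r)"
      using m r by (simp add: ract_assoc)
    then show "x \<cdot>\<^bsub>M\<^esub> r \<in> ?N" by blast
  qed (use m ract_closed in auto)
  then have "?N = {\<zero>\<^bsub>M\<^esub>} \<or> ?N = carrier M" using simple by (simp only: simple_rmodule_def)
  moreover have "m \<in> ?N" using ract_one[OF m(1), symmetric] R.one_closed by blast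
  ultimately have N: "?N = carrier M" using m(2) by auto
  define p where "p x = {r \<in> carrier R. m \<cdot>\<^bsub>M\<^esub> r = x}" for x
  have inj: "inj_on p (carrier M)"
  proof (rule inj_onI)
    fix x y assume "x \<in> carrier M" "p x = p y"
    moreover then obtain r where "r \<in> carrier R" "x = m \<cdot>\<^bsub>M\<^esub> r" using N by blast
    ultimately show "x = y" by (auto simp: p_def)
  qed
  note t = transport_facts[OF inj mod]
  have "singular_rmodule R (transport_rmodule p M)"
    unfolding singular_rmodule_def
  proof (intro conjI ballI)
    fix y assume "y \<in> carrier (transport_rmodule p M)"
    then obtain x where "x \<in> carrier M" "y = p x" by (auto simp: transport_rmodule_def Let_def)
    then show "essential_submodule R (regular_rmodule R) (annihilator R (transport_rmodule p M) y)"
      using sing t(2) by (simp add: singular_rmodule_def)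
  qed (rule t(1))
  from t(4)[OF all[OF t(3)[OF simple] this]] show ?thesis .
qed

end

theory Submission
  imports Defs
begin

text \<open>
  The proof rests on one property of an element \<open>a\<close> of \<open>R\<close>: the epimorphism \<open>R \<rightarrow> aR\<close>,
  \<open>x \<mapsto> ax\<close>, splits. Given a splitting \<open>ax \<mapsto> ex\<close>, the right ideal \<open>eR\<close> is a complement of
  \<open>r(a)\<close> (\<open>right_annihilator_direct_summand\<close>), and homomorphisms on \<open>aR\<close> lift along
  epimorphisms (\<open>lift_from_splitting\<close>).

  Every simple right ideal \<open>T\<close> is \<open>mR\<close> for such an \<open>m\<close>
  (\<open>simple_right_ideal_splitting\<close>). If \<open>r(m)\<close> is not essential for some \<open>m\<close> in \<open>T\<close>, a nonzero
  right ideal that meets \<open>r(m)\<close> trivially is mapped isomorphically onto \<open>T\<close> by \<open>x \<mapsto> mx\<close>, and the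
  inverse map is a splitting. If all these \<open>r(m)\<close> are essential, \<open>T\<close> is a simple singular module
  and hence ss-injective, and then \<open>T\<close> has a left identity: if \<open>T\<close> is small, the identity map of
  \<open>T\<close> extends to a homomorphism \<open>R \<rightarrow> T\<close>, whose value at \<open>1\<close> is one; if \<open>T\<close> is not small,
  it is a direct summand of \<open>R\<close>, and the component of \<open>1\<close> in \<open>T\<close> is one.

  A module that is the sum of its simple submodules is a direct sum of some of them, so that
  homomorphisms can be built one simple submodule at a time. The form used here is
  \<open>extend_hom_to_socle\<close>: a homomorphism on a submodule extends to the socle, also under an
  additive constraint on its values, provided that the constraint can be met on each simple
  submodule. With the constraint of being a lift, this makes the right socle projective.
  Without a constraint, it provides a retraction of the right socle onto \<open>aR\<close> for every \<open>a\<close> in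
  the socle. Hence \<open>aR\<close> inherits the lifting property, so \<open>R \<rightarrow> aR\<close> splits and \<open>r(a)\<close> is a
  direct summand.
\<close>

section \<open>Submodules and homomorphisms\<close>

lemma rmodule_homI:
  assumes "\<And>x. x \<in> carrier M \<Longrightarrow> f x \<in> carrier N"
    and "\<And>x y. \<lbrakk>x \<in> carrier M; y \<in> carrier M\<rbrakk> \<Longrightarrow> f (x \<oplus>\<^bsub>M\<^esub> y) = f x \<oplus>\<^bsub>N\<^esub> f y"
    and "\<And>x r. \<lbrakk>x \<in> carrier M; r \<in> carrier R\<rbrakk> \<Longrightarrow> f (x \<cdot>\<^bsub>M\<^esub> r) = f x \<cdot>\<^bsub>N\<^esub> r"
  shows "f \<in> rmodule_hom R M N"
  using assms by (auto simp: rmodule_hom_def hom_def)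

lemma rmodule_homD:
  assumes "f \<in> rmodule_hom R M N"
  shows "\<And>x. x \<in> carrier M \<Longrightarrow> f x \<in> carrier N"
    and "\<And>x y. \<lbrakk>x \<in> carrier M; y \<in> carrier M\<rbrakk> \<Longrightarrow> f (x \<oplus>\<^bsub>M\<^esub> y) = f x \<oplus>\<^bsub>N\<^esub> f y"
    and "\<And>x r. \<lbrakk>x \<in> carrier M; r \<in> carrier R\<rbrakk> \<Longrightarrow> f (x \<cdot>\<^bsub>M\<^esub> r) = f x \<cdot>\<^bsub>N\<^esub> r"
  using assms by (auto simp: rmodule_hom_def hom_def)

context right_module
begin

lemma ract_zero:
  assumes "x \<in> carrier M"
  shows "x \<cdot>\<^bsub>M\<^esub> \<zero>\<^bsub>R\<^esub> = \<zero>\<^bsub>M\<^esub>"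
proof -
  have "x \<cdot>\<^bsub>M\<^esub> (\<zero>\<^bsub>R\<^esub> \<oplus>\<^bsub>R\<^esub> \<zero>\<^bsub>R\<^esub>) = x \<cdot>\<^bsub>M\<^esub> \<zero>\<^bsub>R\<^esub> \<oplus>\<^bsub>M\<^esub> x \<cdot>\<^bsub>M\<^esub> \<zero>\<^bsub>R\<^esub>"
    using assms by (intro ract_r_distr) auto
  then show ?thesis using assms ract_closed[of x "\<zero>\<^bsub>R\<^esub>"] by simp
qed

lemma zero_ract:
  assumes "r \<in> carrier R"
  shows "\<zero>\<^bsub>M\<^esub> \<cdot>\<^bsub>M\<^esub> r = \<zero>\<^bsub>M\<^esub>"
proof -
  have "(\<zero>\<^bsub>M\<^esub> \<oplus>\<^bsub>M\<^esub> \<zero>\<^bsub>M\<^esub>) \<cdot>\<^bsub>M\<^esub> r = \<zero>\<^bsub>M\<^esub> \<cdot>\<^bsub>M\<^esub> r \<oplus>\<^bsub>M\<^esub> \<zero>\<^bsub>M\<^esub> \<cdot>\<^bsub>M\<^esub> r"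
    using assms by (intro ract_l_distr) auto
  then show ?thesis using assms ract_closed[of "\<zero>\<^bsub>M\<^esub>" r] by simp
qed

lemma ract_minus_one:
  assumes x: "x \<in> carrier M"
  shows "x \<cdot>\<^bsub>M\<^esub> (\<ominus>\<^bsub>R\<^esub> \<one>\<^bsub>R\<^esub>) = \<ominus>\<^bsub>M\<^esub> x"
proof -
  have "x \<cdot>\<^bsub>M\<^esub> (\<one>\<^bsub>R\<^esub> \<oplus>\<^bsub>R\<^esub> \<ominus>\<^bsub>R\<^esub> \<one>\<^bsub>R\<^esub>) = x \<oplus>\<^bsub>M\<^esub> x \<cdot>\<^bsub>M\<^esub> (\<ominus>\<^bsub>R\<^esub> \<one>\<^bsub>R\<^esub>)"
    using x by (simp add: ract_r_distr ract_one del: R.r_neg)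
  then have "x \<oplus>\<^bsub>M\<^esub> x \<cdot>\<^bsub>M\<^esub> (\<ominus>\<^bsub>R\<^esub> \<one>\<^bsub>R\<^esub>) = \<zero>\<^bsub>M\<^esub>" using x by (simp add: R.r_neg ract_zero)
  then show ?thesis
    using x by (intro M.minus_equality[symmetric]) (auto simp: M.a_comm ract_closed)
qed

lemma rsubmodule_minus_closed:
  assumes "rsubmodule R M N" and "x \<in> N"
  shows "\<ominus>\<^bsub>M\<^esub> x \<in> N"
  using rsubmoduleD(4)[OF assms, of "\<ominus>\<^bsub>R\<^esub> \<one>\<^bsub>R\<^esub>"] ract_minus_one[of x] rsubmoduleD(1)[OF assms(1)] assms(2)
  by auto

lemma rsubmodule_is_right_module:
  assumes N: "rsubmodule R M N"
  shows "right_module R (M\<lparr>carrier := N\<rparr>)"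
proof -
  note D = rsubmoduleD[OF N]
  have "abelian_group (M\<lparr>carrier := N\<rparr>)"
  proof (rule abelian_groupI)
    fix x assume "x \<in> carrier (M\<lparr>carrier := N\<rparr>)"
    then have "x \<in> N" by simp
    then show "\<exists>y\<in>carrier (M\<lparr>carrier := N\<rparr>). y \<oplus>\<^bsub>M\<lparr>carrier := N\<rparr>\<^esub> x = \<zero>\<^bsub>M\<lparr>carrier := N\<rparr>\<^esub>"
      using rsubmodule_minus_closed[OF N] D(1) M.l_neg[of x] by auto
  qed (use D in \<open>auto simp: M.a_ac subset_iff\<close>)
  then show ?thesis
    using D by (intro right_module.intro right_module_axioms.intro R.ring_axioms)
       (auto simp: subset_iff ract_closed ract_l_distr ract_r_distr ract_assoc ract_one)
qed

lemma rsubmodule_of_rsubmodule: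
  assumes N: "rsubmodule R M N" and K: "rsubmodule R M K" and "K \<subseteq> N"
  shows "rsubmodule R (M\<lparr>carrier := N\<rparr>) K"
proof -
  interpret N: right_module R "M\<lparr>carrier := N\<rparr>" by (rule rsubmodule_is_right_module[OF N])
  show ?thesis using rsubmoduleD[OF K] assms(3) by (intro N.rsubmoduleI) auto
qed

lemma rsubmodule_zero: "rsubmodule R M {\<zero>\<^bsub>M\<^esub>}"
  by (rule rsubmoduleI) (auto simp: zero_ract)

lemma rsubmodule_carrier: "rsubmodule R M (carrier M)"
  by (rule rsubmoduleI) (auto simp: ract_closed)

lemma rsubmodule_Inter:
  assumes "\<F> \<noteq> {}" and "\<And>N. N \<in> \<F> \<Longrightarrow> rsubmodule R M N"
  shows "rsubmodule R M (\<Inter>\<F>)"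
proof (rule rsubmoduleI)
  show "\<Inter>\<F> \<subseteq> carrier M" using assms rsubmoduleD(1) by fast
qed (use rsubmoduleD(2-4)[OF assms(2)] in auto)

lemma rsubmodule_Int:
  "\<lbrakk>rsubmodule R M K; rsubmodule R M N\<rbrakk> \<Longrightarrow> rsubmodule R M (K \<inter> N)"
  using rsubmodule_Inter[of "{K, N}"] by auto

lemma rsubmodule_socle: "rsubmodule R M (socle R M)"
  unfolding socle_def
  by (rule rsubmodule_Inter) (use rsubmodule_carrier rsubmoduleD(1) in blast)+

lemma socle_least:
  assumes "rsubmodule R M N"
    and "\<And>T. \<lbrakk>rsubmodule R M T; simple_rmodule R (M\<lparr>carrier := T\<rparr>)\<rbrakk> \<Longrightarrow> T \<subseteq> N"
  shows "socle R M \<subseteq> N"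
  using assms unfolding socle_def by blast

lemma simple_subset_socle:
  assumes "rsubmodule R M T" and "simple_rmodule R (M\<lparr>carrier := T\<rparr>)"
  shows "T \<subseteq> socle R M"
  using assms unfolding socle_def by blast

lemma rsubmodule_cyclic:
  assumes m: "m \<in> carrier M" and I: "rsubmodule R (regular_rmodule R) I"
  shows "rsubmodule R M ((\<lambda>r. m \<cdot>\<^bsub>M\<^esub> r) ` I)"
proof -
  note D = rsubmoduleD[OF I, unfolded regular_rmodule_def, simplified]
  show ?thesis
  proof (rule rsubmoduleI)
    show "\<zero>\<^bsub>M\<^esub> \<in> (\<lambda>r. m \<cdot>\<^bsub>M\<^esub> r) ` I"
      using D(2) ract_zero[OF m, symmetric] by blast
    fix x assume "x \<in> (\<lambda>r. m \<cdot>\<^bsub>M\<^esub> r) ` I"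
    then obtain r where r: "r \<in> I" "x = m \<cdot>\<^bsub>M\<^esub> r" by blast
    { fix s assume "s \<in> carrier R"
      then have "x \<cdot>\<^bsub>M\<^esub> s = m \<cdot>\<^bsub>M\<^esub> (r \<otimes>\<^bsub>R\<^esub> s)" "r \<otimes>\<^bsub>R\<^esub> s \<in> I"
        using m r D(1,4) ract_assoc[of m r s] by (auto simp: subset_iff)
      then show "x \<cdot>\<^bsub>M\<^esub> s \<in> (\<lambda>r. m \<cdot>\<^bsub>M\<^esub> r) ` I" by blast }
    { fix y assume "y \<in> (\<lambda>r. m \<cdot>\<^bsub>M\<^esub> r) ` I"
      then obtain s where "s \<in> I" "y = m \<cdot>\<^bsub>M\<^esub> s" by blast
      then have "x \<oplus>\<^bsub>M\<^esub> y = m \<cdot>\<^bsub>M\<^esub> (r \<oplus>\<^bsub>R\<^esub> s)" "r \<oplus>\<^bsub>R\<^esub> s \<in> I"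
        using m r D(1,3) ract_r_distr[of m r s] by (auto simp: subset_iff)
      then show "x \<oplus>\<^bsub>M\<^esub> y \<in> (\<lambda>r. m \<cdot>\<^bsub>M\<^esub> r) ` I" by blast }
  qed (use m D(1) in \<open>auto simp: ract_closed\<close>)
qed

lemma simple_rsubmodule_cases:
  assumes T: "rsubmodule R M T" "simple_rmodule R (M\<lparr>carrier := T\<rparr>)"
    and K: "rsubmodule R M K" "K \<subseteq> T"
  shows "K = {\<zero>\<^bsub>M\<^esub>} \<or> K = T"
  using rsubmodule_of_rsubmodule[OF T(1) K] T(2) by (simp add: simple_rmodule_def)

lemma simple_rsubmodule_nonzero:
  assumes T: "rsubmodule R M T" "simple_rmodule R (M\<lparr>carrier := T\<rparr>)"
  obtains m where "m \<in> T" "m \<noteq> \<zero>\<^bsub>M\<^esub>"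
  using T rsubmoduleD(2)[OF T(1)] by (auto simp: simple_rmodule_def)

section \<open>Extending homomorphisms through the socle\<close>

text \<open>
  Zorn's lemma replaces a decomposition of the socle into a direct sum: among the graphs of
  homomorphisms that extend \<open>h0\<close> and satisfy the constraint \<open>Q\<close>, take a maximal one. A simple
  submodule not contained in its domain would meet the domain trivially, so the sum would be
  direct and the homomorphism available on the simple submodule could be added. The constraint
  \<open>Q\<close> makes the lemma cover lifting problems (\<open>Q x y\<close> says that \<open>y\<close> lies over the prescribed
  image of \<open>x\<close>) as well as plain extension problems.
\<close>

lemma extend_hom_to_socle:
  fixes A (structure)
  assumes A: "right_module R A"
    and N: "rsubmodule R M N" and h0: "h0 \<in> rmodule_hom R (M\<lparr>carrier := N\<rparr>) A"
    and Q0: "\<And>x. x \<in> N \<Longrightarrow> Q x (h0 x)"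
    and Qadd: "\<And>x y x' y'. \<lbrakk>x \<in> carrier M; x' \<in> carrier M; y \<in> carrier A; y' \<in> carrier A;
      Q x y; Q x' y'\<rbrakk> \<Longrightarrow> Q (x \<oplus>\<^bsub>M\<^esub> x') (y \<oplus>\<^bsub>A\<^esub> y')"
    and simple: "\<And>T. \<lbrakk>rsubmodule R M T; simple_rmodule R (M\<lparr>carrier := T\<rparr>)\<rbrakk> \<Longrightarrow>
      \<exists>h\<in>rmodule_hom R (M\<lparr>carrier := T\<rparr>) A. \<forall>x\<in>T. Q x (h x)"
  shows "\<exists>h\<in>rmodule_hom R (M\<lparr>carrier := socle R M\<rparr>) A.
    (\<forall>x\<in>socle R M. Q x (h x)) \<and> (\<forall>x\<in>N \<inter> socle R M. h x = h0 x)"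
proof -
  interpret A: right_module R A by (rule A)
  \<comment> \<open>For a subset of \<open>M \<times> A\<close> closed under addition and the action, containing no \<open>(0, y)\<close> with
    \<open>y \<noteq> 0\<close> is the same as being single-valued, and it is easier to check for a sum of two graphs.\<close>
  define hom_graph where "hom_graph G \<longleftrightarrow>
      (\<forall>p\<in>G. fst p \<in> carrier M \<and> snd p \<in> carrier A \<and> Q (fst p) (snd p)) \<and>
      (\<forall>p\<in>G. \<forall>q\<in>G. (fst p \<oplus>\<^bsub>M\<^esub> fst q, snd p \<oplus>\<^bsub>A\<^esub> snd q) \<in> G) \<and>
      (\<forall>p\<in>G. \<forall>r\<in>carrier R. (fst p \<cdot>\<^bsub>M\<^esub> r, snd p \<cdot>\<^bsub>A\<^esub> r) \<in> G) \<and>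
      (\<forall>y. (\<zero>\<^bsub>M\<^esub>, y) \<in> G \<longrightarrow> y = \<zero>\<^bsub>A\<^esub>)" for G
  define G0 where "G0 = (\<lambda>x. (x, h0 x)) ` N"
  define \<G> where "\<G> = {G. hom_graph G \<and> G0 \<subseteq> G}"
  note ND = rsubmoduleD[OF N]
  note h0D = rmodule_homD[OF h0, simplified]
  have hom0: "h \<zero>\<^bsub>M\<^esub> = \<zero>\<^bsub>A\<^esub>" if K: "rsubmodule R M K" and h: "h \<in> rmodule_hom R (M\<lparr>carrier := K\<rparr>) A"
    for K h
  proof -
    note hD = rmodule_homD[OF h, simplified]
    have "h (\<zero>\<^bsub>M\<^esub> \<cdot>\<^bsub>M\<^esub> \<zero>\<^bsub>R\<^esub>) = h \<zero>\<^bsub>M\<^esub> \<cdot>\<^bsub>A\<^esub> \<zero>\<^bsub>R\<^esub>" using rsubmoduleD(2)[OF K] hD(3) by blast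
    then show ?thesis using ract_zero A.ract_zero rsubmoduleD(2)[OF K] hD(1) by simp
  qed
  have G0: "hom_graph G0"
    unfolding hom_graph_def
  proof (intro conjI)
    show "\<forall>p\<in>G0. \<forall>q\<in>G0. (fst p \<oplus>\<^bsub>M\<^esub> fst q, snd p \<oplus>\<^bsub>A\<^esub> snd q) \<in> G0"
      using ND(3) h0D(2) by (auto simp: G0_def image_iff)
    show "\<forall>p\<in>G0. \<forall>r\<in>carrier R. (fst p \<cdot>\<^bsub>M\<^esub> r, snd p \<cdot>\<^bsub>A\<^esub> r) \<in> G0"
      using ND(4) h0D(3) by (auto simp: G0_def image_iff)
  qed (use ND(1) h0D(1) Q0 hom0[OF N h0] in \<open>auto simp: G0_def\<close>)
  have "\<exists>G\<in>\<G>. \<forall>X\<in>\<G>. G \<subseteq> X \<longrightarrow> X = G"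
  proof (rule subset_Zorn_nonempty)
    show "\<G> \<noteq> {}" using G0 by (auto simp: \<G>_def)
    fix C assume C: "C \<noteq> {}" "subset.chain \<G> C"
    have Cg: "hom_graph G" "G0 \<subseteq> G" if "G \<in> C" for G
      using C(2) that by (auto simp: \<G>_def subset_chain_def)
    have both: "\<exists>G\<in>C. p \<in> G \<and> q \<in> G" if "p \<in> \<Union>C" "q \<in> \<Union>C" for p q
      using C(2) that unfolding subset_chain_def by blast
    have "hom_graph (\<Union>C)"
      unfolding hom_graph_def
    proof (intro conjI ballI)
      fix p q assume "p \<in> \<Union>C" "q \<in> \<Union>C"
      from both[OF this] obtain G where G: "G \<in> C" "p \<in> G" "q \<in> G" by blast
      then show "(fst p \<oplus>\<^bsub>M\<^esub> fst q, snd p \<oplus>\<^bsub>A\<^esub> snd q) \<in> \<Union>C"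
        using Cg(1)[OF G(1)] unfolding hom_graph_def by blast
    next
      fix p r assume "p \<in> \<Union>C" "r \<in> carrier R"
      then show "(fst p \<cdot>\<^bsub>M\<^esub> r, snd p \<cdot>\<^bsub>A\<^esub> r) \<in> \<Union>C" using Cg(1) unfolding hom_graph_def by blast
    qed (use Cg(1) in \<open>unfold hom_graph_def, blast+\<close>)
    moreover have "G0 \<subseteq> \<Union>C" using C(1) Cg(2) by blast
    ultimately show "\<Union>C \<in> \<G>" by (simp add: \<G>_def)
  qed
  then obtain G where "G \<in> \<G>" and G_max: "\<forall>X\<in>\<G>. G \<subseteq> X \<longrightarrow> X = G" by (elim bexE)
  then have G: "hom_graph G" "G0 \<subseteq> G" by (simp_all add: \<G>_def)
  have max: "X = G" if "hom_graph X" "G \<subseteq> X" for X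
    using G_max that G(2) by (simp add: \<G>_def)
  have GC: "x \<in> carrier M" "y \<in> carrier A" "Q x y" if "(x, y) \<in> G" for x y
    using G(1) that unfolding hom_graph_def by force+
  have Gadd: "(x \<oplus>\<^bsub>M\<^esub> x', y \<oplus>\<^bsub>A\<^esub> y') \<in> G" if "(x, y) \<in> G" "(x', y') \<in> G" for x y x' y'
    using G(1) that unfolding hom_graph_def by fastforce
  have Gact: "(x \<cdot>\<^bsub>M\<^esub> r, y \<cdot>\<^bsub>A\<^esub> r) \<in> G" if "(x, y) \<in> G" "r \<in> carrier R" for x y r
    using G(1) that unfolding hom_graph_def by fastforce
  have Gz: "y = \<zero>\<^bsub>A\<^esub>" if "(\<zero>\<^bsub>M\<^esub>, y) \<in> G" for y using G(1) that unfolding hom_graph_def by blast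
  have G00: "(\<zero>\<^bsub>M\<^esub>, \<zero>\<^bsub>A\<^esub>) \<in> G" using G(2) ND(2) hom0[OF N h0] by (force simp: G0_def)
  have Gneg: "(\<ominus>\<^bsub>M\<^esub> x, \<ominus>\<^bsub>A\<^esub> y) \<in> G" if "(x, y) \<in> G" for x y
    using Gact[OF that, of "\<ominus>\<^bsub>R\<^esub> \<one>\<^bsub>R\<^esub>"] GC[OF that] by (simp add: ract_minus_one A.ract_minus_one)
  have Gun: "y = y'" if "(x, y) \<in> G" "(x, y') \<in> G" for x y y'
  proof -
    have "(x \<oplus>\<^bsub>M\<^esub> \<ominus>\<^bsub>M\<^esub> x, y \<oplus>\<^bsub>A\<^esub> \<ominus>\<^bsub>A\<^esub> y') \<in> G" using Gadd Gneg that by blast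
    then have "y \<oplus>\<^bsub>A\<^esub> \<ominus>\<^bsub>A\<^esub> y' = \<zero>\<^bsub>A\<^esub>" using Gz GC(1)[OF that(1)] by (simp add: M.r_neg)
    then show ?thesis
      using A.M.minus_equality[of y "\<ominus>\<^bsub>A\<^esub> y'"] GC(2)[OF that(1)] GC(2)[OF that(2)] by simp
  qed
  have Dom: "rsubmodule R M (Domain G)"
    by (rule rsubmoduleI) (use GC(1) G00 in \<open>auto intro: DomainI dest: Gadd Gact\<close>)
  have "socle R M \<subseteq> Domain G"
  proof (rule socle_least[OF Dom])
    fix T assume T: "rsubmodule R M T" "simple_rmodule R (M\<lparr>carrier := T\<rparr>)"
    note TD = rsubmoduleD[OF T(1)]
    show "T \<subseteq> Domain G"
    proof (rule ccontr)
      assume nT: "\<not> T \<subseteq> Domain G"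
      then have int: "Domain G \<inter> T = {\<zero>\<^bsub>M\<^esub>}"
        using simple_rsubmodule_cases[OF T rsubmodule_Int[OF Dom T(1)]] by blast
      obtain h where h: "h \<in> rmodule_hom R (M\<lparr>carrier := T\<rparr>) A" and Qh: "\<And>x. x \<in> T \<Longrightarrow> Q x (h x)"
        using simple[OF T] by blast
      note hD = rmodule_homD[OF h, simplified]
      note h00 = hom0[OF T(1) h]
      \<comment> \<open>the graph of the homomorphism on \<open>Domain G \<oplus> T\<close> given by \<open>G\<close> and \<open>h\<close>\<close>
      define X where "X = {(x \<oplus>\<^bsub>M\<^esub> t, y \<oplus>\<^bsub>A\<^esub> h t) |x y t. (x, y) \<in> G \<and> t \<in> T}"
      have XI: "(x \<oplus>\<^bsub>M\<^esub> t, y \<oplus>\<^bsub>A\<^esub> h t) \<in> X" if "(x, y) \<in> G" "t \<in> T" for x y t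
        using that by (auto simp: X_def)
      have TC: "t \<in> carrier M" "h t \<in> carrier A" if "t \<in> T" for t
        using that TD(1) hD(1) by auto
      have "hom_graph X"
        unfolding hom_graph_def
      proof (intro conjI ballI allI impI)
        fix p assume "p \<in> X"
        then obtain x y t where p: "p = (x \<oplus>\<^bsub>M\<^esub> t, y \<oplus>\<^bsub>A\<^esub> h t)" "(x, y) \<in> G" "t \<in> T"
          by (auto simp: X_def)
        note pc = GC[OF p(2)] TC[OF p(3)]
        show "fst p \<in> carrier M" "snd p \<in> carrier A" "Q (fst p) (snd p)"
          using pc p Qh Qadd by auto
        { fix q assume "q \<in> X"
          then obtain x' y' t' where q: "q = (x' \<oplus>\<^bsub>M\<^esub> t', y' \<oplus>\<^bsub>A\<^esub> h t')" "(x', y') \<in> G" "t' \<in> T"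
            by (auto simp: X_def)
          note qc = GC[OF q(2)] TC[OF q(3)]
          have "fst p \<oplus>\<^bsub>M\<^esub> fst q = (x \<oplus>\<^bsub>M\<^esub> x') \<oplus>\<^bsub>M\<^esub> (t \<oplus>\<^bsub>M\<^esub> t')"
            using pc qc p q by (simp add: M.a_ac)
          moreover have "snd p \<oplus>\<^bsub>A\<^esub> snd q = (y \<oplus>\<^bsub>A\<^esub> y') \<oplus>\<^bsub>A\<^esub> h (t \<oplus>\<^bsub>M\<^esub> t')"
            using pc qc p q hD(2) by (simp add: A.M.a_ac)
          ultimately show "(fst p \<oplus>\<^bsub>M\<^esub> fst q, snd p \<oplus>\<^bsub>A\<^esub> snd q) \<in> X"
            using XI[OF Gadd[OF p(2) q(2)] TD(3)[OF p(3) q(3)]] by simp }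
        { fix r assume r: "r \<in> carrier R"
          have "fst p \<cdot>\<^bsub>M\<^esub> r = x \<cdot>\<^bsub>M\<^esub> r \<oplus>\<^bsub>M\<^esub> t \<cdot>\<^bsub>M\<^esub> r"
            using pc p r by (simp add: ract_l_distr)
          moreover have "snd p \<cdot>\<^bsub>A\<^esub> r = y \<cdot>\<^bsub>A\<^esub> r \<oplus>\<^bsub>A\<^esub> h (t \<cdot>\<^bsub>M\<^esub> r)"
            using pc p r hD(3) by (simp add: A.ract_l_distr)
          ultimately show "(fst p \<cdot>\<^bsub>M\<^esub> r, snd p \<cdot>\<^bsub>A\<^esub> r) \<in> X"
            using XI[OF Gact[OF p(2) r] TD(4)[OF p(3) r]] by simp }
      next
        fix z assume "(\<zero>\<^bsub>M\<^esub>, z) \<in> X"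
        then obtain x y t where p: "\<zero>\<^bsub>M\<^esub> = x \<oplus>\<^bsub>M\<^esub> t" "z = y \<oplus>\<^bsub>A\<^esub> h t" "(x, y) \<in> G" "t \<in> T"
          by (auto simp: X_def)
        note pc = GC[OF p(3)] TC[OF p(4)]
        have "x = \<ominus>\<^bsub>M\<^esub> t" using M.minus_equality[of x t] pc p(1) by simp
        then have "x \<in> T" using rsubmodule_minus_closed[OF T(1) p(4)] by simp
        then have x0: "x = \<zero>\<^bsub>M\<^esub>" using int p(3) by blast
        then have t0: "t = \<zero>\<^bsub>M\<^esub>" using p(1)[symmetric] pc(4) by simp
        have "y = \<zero>\<^bsub>A\<^esub>" using Gz p(3) x0 by simp
        then show "z = \<zero>\<^bsub>A\<^esub>" using t0 p(2) h00 by simp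
      qed
      moreover have "G \<subseteq> X"
      proof
        fix p assume "p \<in> G"
        moreover then obtain x y where "p = (x, y)" by (cases p)
        ultimately show "p \<in> X" using XI[of x y "\<zero>\<^bsub>M\<^esub>"] GC[of x y] TD(2) h00 by simp
      qed
      ultimately have "X = G" by (rule max)
      moreover have "t \<in> Domain X" if "t \<in> T" for t
        using XI[OF G00 that] TC[OF that] by auto
      ultimately show False using nT by blast
    qed
  qed
  define h where "h x = (SOME y. (x, y) \<in> G)" for x
  have hG: "(x, h x) \<in> G" if "x \<in> socle R M" for x
    using someI_ex[of "\<lambda>y. (x, y) \<in> G"] \<open>socle R M \<subseteq> Domain G\<close> that by (auto simp: h_def)
  note SD = rsubmoduleD[OF rsubmodule_socle]
  have "h \<in> rmodule_hom R (M\<lparr>carrier := socle R M\<rparr>) A"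
  proof (rule rmodule_homI; simp)
    fix x assume x: "x \<in> socle R M"
    show "h x \<in> carrier A" using GC(2)[OF hG[OF x]] .
    { fix y assume y: "y \<in> socle R M"
      show "h (x \<oplus>\<^bsub>M\<^esub> y) = h x \<oplus>\<^bsub>A\<^esub> h y"
        using Gun[OF hG[OF SD(3)[OF x y]] Gadd[OF hG[OF x] hG[OF y]]] . }
    { fix r assume r: "r \<in> carrier R"
      show "h (x \<cdot>\<^bsub>M\<^esub> r) = h x \<cdot>\<^bsub>A\<^esub> r"
        using Gun[OF hG[OF SD(4)[OF x r]] Gact[OF hG[OF x] r]] . }
  qed
  moreover have "\<forall>x\<in>socle R M. Q x (h x)" using GC(3) hG by blast
  moreover have "h x = h0 x" if "x \<in> N \<inter> socle R M" for x
    using Gun[of x "h x" "h0 x"] hG that G(2) by (auto simp: G0_def)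
  ultimately show ?thesis by blast
qed

end

section \<open>Elements whose annihilator splits off\<close>

text \<open>
  The data of a splitting \<open>ax \<mapsto> ex\<close> of the epimorphism \<open>R \<rightarrow> aR\<close>: the last condition says that
  this map is well defined, and \<open>ae = a\<close> that it is a section. The element \<open>e\<close> is then an
  idempotent with \<open>r(e) = r(a)\<close>.
\<close>

definition annihilator_splitting :: "('a, 'b) ring_scheme \<Rightarrow> 'a \<Rightarrow> 'a \<Rightarrow> bool" where
  "annihilator_splitting R a e \<longleftrightarrow>
    a \<in> carrier R \<and> e \<in> carrier R \<and> a \<otimes>\<^bsub>R\<^esub> e = a \<and>
    (\<forall>x\<in>carrier R. a \<otimes>\<^bsub>R\<^esub> x = \<zero>\<^bsub>R\<^esub> \<longrightarrow> e \<otimes>\<^bsub>R\<^esub> x = \<zero>\<^bsub>R\<^esub>)"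

lemma regular_rmodule_simps [simp]:
  "carrier (regular_rmodule R) = carrier R" "\<zero>\<^bsub>regular_rmodule R\<^esub> = \<zero>\<^bsub>R\<^esub>"
  "x \<oplus>\<^bsub>regular_rmodule R\<^esub> y = x \<oplus>\<^bsub>R\<^esub> y" "x \<cdot>\<^bsub>regular_rmodule R\<^esub> y = x \<otimes>\<^bsub>R\<^esub> y"
  by (simp_all add: regular_rmodule_def)

context ring
begin

lemma regular_right_module: "right_module R (regular_rmodule R)"
proof -
  have "abelian_group (regular_rmodule R)"
  proof (rule abelian_groupI)
    fix x assume "x \<in> carrier (regular_rmodule R)"
    then show "\<exists>y\<in>carrier (regular_rmodule R). y \<oplus>\<^bsub>regular_rmodule R\<^esub> x = \<zero>\<^bsub>regular_rmodule R\<^esub>"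
      using l_neg[of x] by auto
  qed (auto simp: a_ac)
  then show ?thesis
    by (intro right_module.intro right_module_axioms.intro ring_axioms)
       (auto simp: l_distr r_distr m_assoc)
qed

interpretation Reg: right_module R "regular_rmodule R"
  by (rule regular_right_module)

lemma right_ideal_minus_closed:
  assumes I: "right_ideal R I" and "x \<in> I" "y \<in> I"
  shows "x \<oplus> \<ominus> y \<in> I"
proof -
  have xy: "x \<in> carrier R" "y \<in> carrier R" using rsubmoduleD(1)[OF I] assms by auto
  have "y \<otimes> \<ominus> \<one> \<in> I" using rsubmoduleD(4)[OF I \<open>y \<in> I\<close>, of "\<ominus> \<one>"] by simp
  then have "\<ominus> y \<in> I" using xy by (simp add: r_minus)
  then show ?thesis using rsubmoduleD(3)[OF I \<open>x \<in> I\<close>] by simp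
qed

lemma right_ideal_principal: "a \<in> carrier R \<Longrightarrow> right_ideal R ((\<otimes>) a ` carrier R)"
  using Reg.rsubmodule_cyclic[OF _ Reg.rsubmodule_carrier, of a] by simp

text \<open>The complement is \<open>eR\<close>, by the decomposition \<open>x = (x - ex) + ex\<close>.\<close>

lemma right_annihilator_direct_summand:
  assumes "annihilator_splitting R a e"
  shows "direct_summand R (regular_rmodule R) (right_annihilator R a)"
proof -
  from assms have a: "a \<in> carrier R" and e: "e \<in> carrier R" and ae: "a \<otimes> e = a"
    and ann: "\<And>x. \<lbrakk>x \<in> carrier R; a \<otimes> x = \<zero>\<rbrakk> \<Longrightarrow> e \<otimes> x = \<zero>"
    by (auto simp: annihilator_splitting_def)
  let ?L = "(\<otimes>) e ` carrier R"
  have aea: "a \<otimes> (e \<otimes> x) = a \<otimes> x" if "x \<in> carrier R" for x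
    using a e ae that m_assoc[of a e x] by simp
  have "right_ideal R (right_annihilator R a)"
    by (rule Reg.rsubmoduleI)
       (use a in \<open>auto simp: right_annihilator_def r_distr m_assoc[symmetric]\<close>)
  moreover have "right_annihilator R a \<inter> ?L = {\<zero>}"
  proof
    show "right_annihilator R a \<inter> ?L \<subseteq> {\<zero>}"
      using aea ann by (auto simp: right_annihilator_def)
    have "\<zero> = e \<otimes> \<zero>" using e by simp
    then show "{\<zero>} \<subseteq> right_annihilator R a \<inter> ?L"
      using a by (auto simp: right_annihilator_def)
  qed
  moreover have "right_annihilator R a <+>\<^bsub>regular_rmodule R\<^esub> ?L = carrier R"
  proof
    show "right_annihilator R a <+>\<^bsub>regular_rmodule R\<^esub> ?L \<subseteq> carrier R"
      using e by (auto simp: set_add_def' right_annihilator_def)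
    show "carrier R \<subseteq> right_annihilator R a <+>\<^bsub>regular_rmodule R\<^esub> ?L"
    proof
      fix x assume x: "x \<in> carrier R"
      have "a \<otimes> (x \<oplus> \<ominus> (e \<otimes> x)) = \<zero>"
        using a e x aea[OF x] by (simp add: r_distr r_minus r_neg)
      moreover have "x = (x \<oplus> \<ominus> (e \<otimes> x)) \<oplus> e \<otimes> x" using e x by (simp add: a_assoc l_neg)
      ultimately show "x \<in> right_annihilator R a <+>\<^bsub>regular_rmodule R\<^esub> ?L"
        unfolding set_add_def' right_annihilator_def regular_rmodule_simps using e x
        by (intro UN_I[of "x \<oplus> \<ominus> (e \<otimes> x)"] UN_I[of "e \<otimes> x"]) auto
    qed
  qed
  ultimately show ?thesis
    using right_ideal_principal[OF e] unfolding direct_summand_def by (metis regular_rmodule_simps(1,2))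
qed

text \<open>
  The splitting makes \<open>mR\<close> isomorphic to a direct summand of the free module \<open>R\<close>. Explicitly, for a
  preimage \<open>b\<close> of \<open>f m\<close> the lift is \<open>mr \<mapsto> b(er)\<close>; the factor \<open>e\<close> makes it independent of the choice
  of \<open>r\<close>.
\<close>

lemma lift_from_splitting:
  assumes spl: "annihilator_splitting R m e"
    and A: "right_module R A" and B: "right_module R B"
    and g: "g \<in> rmodule_hom R A B" "g ` carrier A = carrier B"
    and f: "f \<in> rmodule_hom R ((regular_rmodule R)\<lparr>carrier := (\<otimes>) m ` carrier R\<rparr>) B"
  shows "\<exists>h\<in>rmodule_hom R ((regular_rmodule R)\<lparr>carrier := (\<otimes>) m ` carrier R\<rparr>) A.
    \<forall>x\<in>(\<otimes>) m ` carrier R. g (h x) = f x"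
proof -
  interpret A: right_module R A by (rule A)
  interpret B: right_module R B by (rule B)
  from spl have m: "m \<in> carrier R" and e: "e \<in> carrier R" and me: "m \<otimes> e = m"
    and ann: "\<And>x. \<lbrakk>x \<in> carrier R; m \<otimes> x = \<zero>\<rbrakk> \<Longrightarrow> e \<otimes> x = \<zero>"
    by (auto simp: annihilator_splitting_def)
  note gD = rmodule_homD[OF g(1)]
  note fD = rmodule_homD[OF f, simplified]
  have mT: "m \<in> (\<otimes>) m ` carrier R" using m r_one[of m] one_closed by (metis image_eqI)
  then obtain b where b: "b \<in> carrier A" "g b = f m" using g(2) fD(1) by (metis imageE)
  define h where "h x = b \<cdot>\<^bsub>A\<^esub> (e \<otimes> (SOME r. r \<in> carrier R \<and> x = m \<otimes> r))" for x
  have h: "h (m \<otimes> r) = b \<cdot>\<^bsub>A\<^esub> (e \<otimes> r)" if r: "r \<in> carrier R" for r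
  proof -
    define s where "s = (SOME s. s \<in> carrier R \<and> m \<otimes> r = m \<otimes> s)"
    have s: "s \<in> carrier R" "m \<otimes> r = m \<otimes> s"
      using someI[of "\<lambda>s. s \<in> carrier R \<and> m \<otimes> r = m \<otimes> s" r] r by (auto simp: s_def)
    have "m \<otimes> (r \<oplus> \<ominus> s) = \<zero>" using m r s by (simp add: r_distr r_minus r_neg)
    then have "e \<otimes> (r \<oplus> \<ominus> s) = \<zero>" using ann r s by simp
    then have "e \<otimes> r \<oplus> \<ominus> (e \<otimes> s) = \<zero>" using e r s by (simp add: r_distr r_minus)
    then have "e \<otimes> r = e \<otimes> s" using e r s minus_equality[of "e \<otimes> r" "\<ominus> (e \<otimes> s)"] by simp
    then show ?thesis by (simp add: h_def s_def)
  qed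
  have "h \<in> rmodule_hom R ((regular_rmodule R)\<lparr>carrier := (\<otimes>) m ` carrier R\<rparr>) A"
  proof (rule rmodule_homI; clarsimp)
    fix r assume r: "r \<in> carrier R"
    show "h (m \<otimes> r) \<in> carrier A" using b e r by (simp add: h A.ract_closed)
    fix s assume s: "s \<in> carrier R"
    show "h (m \<otimes> r \<oplus> m \<otimes> s) = h (m \<otimes> r) \<oplus>\<^bsub>A\<^esub> h (m \<otimes> s)"
      using m e b r s h[of "r \<oplus> s"] by (simp add: h r_distr A.ract_r_distr)
    show "h (m \<otimes> r \<otimes> s) = h (m \<otimes> r) \<cdot>\<^bsub>A\<^esub> s"
      using m e b r s h[of "r \<otimes> s"]
      by (simp add: h m_assoc A.ract_assoc[symmetric] del: A.ract_assoc)
  qed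
  moreover have "g (h (m \<otimes> r)) = f (m \<otimes> r)" if r: "r \<in> carrier R" for r
  proof -
    have "g (h (m \<otimes> r)) = f m \<cdot>\<^bsub>B\<^esub> (e \<otimes> r)" using e r b gD(3) by (simp add: h)
    also have "\<dots> = f (m \<otimes> (e \<otimes> r))" using fD(3)[OF mT, of "e \<otimes> r"] e r by simp
    also have "m \<otimes> (e \<otimes> r) = m \<otimes> r" using m e r me m_assoc[of m e r] by simp
    finally show ?thesis .
  qed
  ultimately show ?thesis by blast
qed

section \<open>Simple right ideals\<close>

text \<open>
  Multiplication by \<open>m\<close> maps any right ideal \<open>I\<close> onto a submodule of \<open>T\<close>. Taking \<open>I = R\<close> gives
  \<open>T = mR\<close>; a nonzero \<open>I\<close> with \<open>r(m) \<inter> I = 0\<close> yields a splitting, because \<open>m\<close> itself then has the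
  form \<open>me\<close> with \<open>e\<close> in \<open>I\<close>.
\<close>

lemma simple_right_ideal_principal:
  assumes T: "right_ideal R T" "simple_rmodule R ((regular_rmodule R)\<lparr>carrier := T\<rparr>)"
    and I: "right_ideal R I" and m: "m \<in> T" "x \<in> I" "m \<otimes> x \<noteq> \<zero>"
  shows "(\<otimes>) m ` I = T"
proof -
  have mR: "m \<in> carrier R" using rsubmoduleD(1)[OF T(1)] m by auto
  have "right_ideal R ((\<otimes>) m ` I)" using Reg.rsubmodule_cyclic[OF _ I, of m] mR by simp
  moreover have "(\<otimes>) m ` I \<subseteq> T"
    using rsubmoduleD(4)[OF T(1) m(1)] rsubmoduleD(1)[OF I] by auto
  ultimately have "(\<otimes>) m ` I = {\<zero>} \<or> (\<otimes>) m ` I = T"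
    using Reg.simple_rsubmodule_cases[OF T] by simp
  then show ?thesis using m by blast
qed

text \<open>
  If \<open>T + L = R\<close> with \<open>L\<close> proper, simplicity forces \<open>T \<inter> L = 0\<close>, and left multiplication by the
  component of \<open>1\<close> in \<open>T\<close> is the projection onto \<open>T\<close> along \<open>L\<close>.
\<close>

lemma non_small_left_identity:
  assumes T: "right_ideal R T" "simple_rmodule R ((regular_rmodule R)\<lparr>carrier := T\<rparr>)"
    and not_small: "\<not> small_submodule R (regular_rmodule R) T"
  shows "\<exists>e\<in>T. \<forall>x\<in>T. e \<otimes> x = x"
proof -
  obtain L where L: "right_ideal R L" "L \<noteq> carrier R" "T <+>\<^bsub>regular_rmodule R\<^esub> L = carrier R"
    using not_small T(1) by (auto simp: small_submodule_def)
  note TD = rsubmoduleD[OF T(1), simplified] and LD = rsubmoduleD[OF L(1), simplified]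
  have split: "\<exists>t\<in>T. \<exists>l\<in>L. x = t \<oplus> l" if "x \<in> carrier R" for x
    using that L(3)[symmetric] unfolding set_add_def' by auto
  have "\<not> T \<subseteq> L"
  proof
    assume "T \<subseteq> L"
    then have "carrier R \<subseteq> L" using split LD(3) by blast
    then show False using L(2) LD(1) by blast
  qed
  then have int: "T \<inter> L = {\<zero>}"
    using Reg.simple_rsubmodule_cases[OF T Reg.rsubmodule_Int[OF T(1) L(1)]] by auto
  obtain t l where t: "t \<in> T" and l: "l \<in> L" and one: "\<one> = t \<oplus> l" using split[OF one_closed] by blast
  have "t \<otimes> x = x" if x: "x \<in> T" for x
  proof -
    have c: "t \<in> carrier R" "l \<in> carrier R" "x \<in> carrier R" using t l x TD(1) LD(1) by auto
    have x_eq: "t \<otimes> x \<oplus> l \<otimes> x = x" using c one l_distr[of t l x] l_one[of x] by metis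
    have "l \<otimes> x = x \<oplus> \<ominus> (t \<otimes> x)"
      using r_neg1[of "t \<otimes> x" "l \<otimes> x"] c by (simp add: x_eq a_comm)
    then have "l \<otimes> x \<in> T \<inter> L"
      using right_ideal_minus_closed[OF T(1) x TD(4)[OF t c(3)]] LD(4)[OF l c(3)] by simp
    then show ?thesis using x_eq int c by auto
  qed
  then show ?thesis using t by blast
qed

lemma simple_right_ideal_semisimple:
  assumes T: "right_ideal R T" "simple_rmodule R ((regular_rmodule R)\<lparr>carrier := T\<rparr>)"
  shows "semisimple_rmodule R ((regular_rmodule R)\<lparr>carrier := T\<rparr>)"
proof -
  interpret T: right_module R "(regular_rmodule R)\<lparr>carrier := T\<rparr>"
    by (rule Reg.rsubmodule_is_right_module[OF T(1)])
  have "T \<subseteq> socle R ((regular_rmodule R)\<lparr>carrier := T\<rparr>)"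
    using T.simple_subset_socle[OF T.rsubmodule_carrier] T(2) by simp
  moreover have "socle R ((regular_rmodule R)\<lparr>carrier := T\<rparr>) \<subseteq> T"
    using rsubmoduleD(1)[OF T.rsubmodule_socle] by simp
  ultimately show ?thesis by (simp add: semisimple_rmodule_def T.right_module_axioms)
qed

text \<open>
  An extension \<open>R \<rightarrow> T\<close> of the identity map of \<open>T\<close> is left multiplication by its value at \<open>1\<close>.
\<close>

lemma ss_injective_left_identity:
  assumes T: "right_ideal R T" "simple_rmodule R ((regular_rmodule R)\<lparr>carrier := T\<rparr>)"
    and small: "small_submodule R (regular_rmodule R) T"
    and inj: "ss_injective R ((regular_rmodule R)\<lparr>carrier := T\<rparr>)"
  shows "\<exists>e\<in>T. \<forall>x\<in>T. e \<otimes> x = x"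
proof -
  have "id \<in> rmodule_hom R ((regular_rmodule R)\<lparr>carrier := T\<rparr>) ((regular_rmodule R)\<lparr>carrier := T\<rparr>)"
    by (rule rmodule_homI) auto
  then obtain g where g: "g \<in> rmodule_hom R (regular_rmodule R) ((regular_rmodule R)\<lparr>carrier := T\<rparr>)"
    and gid: "\<And>x. x \<in> T \<Longrightarrow> g x = x"
    using inj T(1) simple_right_ideal_semisimple[OF T] small
    unfolding ss_injective_def by (metis id_apply)
  note gD = rmodule_homD[OF g, simplified]
  have "g \<one> \<otimes> x = x" if "x \<in> T" for x
    using gD(3)[OF one_closed, of x] gid[OF that] rsubmoduleD(1)[OF T(1)] that by auto
  then show ?thesis using gD(1)[OF one_closed] by blast
qed

text \<open>
  This is where the hypothesis on simple singular modules enters: either some \<open>r(m)\<close> with \<open>m\<close> in \<open>T\<close>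
  fails to be essential and \<open>m\<close> splits, or \<open>T\<close> is itself a simple singular module.
\<close>

lemma simple_right_ideal_splitting:
  assumes all: "\<And>M :: ('a, 'a set) rmodule.
      simple_rmodule R M \<Longrightarrow> singular_rmodule R M \<Longrightarrow> ss_injective R M"
    and T: "right_ideal R T" "simple_rmodule R ((regular_rmodule R)\<lparr>carrier := T\<rparr>)"
  shows "\<exists>m e. T = (\<otimes>) m ` carrier R \<and> annihilator_splitting R m e"
proof -
  note TD = rsubmoduleD[OF T(1), simplified]
  have "\<exists>m\<in>T. m \<noteq> \<zero> \<and> (\<exists>e. annihilator_splitting R m e)"
  proof (cases "\<exists>m\<in>T. \<exists>L. right_ideal R L \<and> L \<noteq> {\<zero>} \<and> right_annihilator R m \<inter> L = {\<zero>}")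
    case True
    then obtain m L where m: "m \<in> T" and L: "right_ideal R L" "L \<noteq> {\<zero>}"
      and int: "right_annihilator R m \<inter> L = {\<zero>}" by blast
    note LD = rsubmoduleD[OF L(1), simplified]
    have mR: "m \<in> carrier R" using m TD(1) by blast
    obtain y where y: "y \<in> L" "y \<noteq> \<zero>" using L(2) LD(2) by blast
    have my: "m \<otimes> y \<noteq> \<zero>" using int y LD(1) by (auto simp: right_annihilator_def)
    have "m \<in> (\<otimes>) m ` L" using simple_right_ideal_principal[OF T L(1) m y(1) my] m by simp
    then obtain e where e: "e \<in> L" "m = m \<otimes> e" by blast
    have eR: "e \<in> carrier R" using e LD(1) by blast
    \<comment> \<open>\<open>ex\<close> lies in \<open>L\<close>, and in \<open>r(m)\<close> as soon as \<open>mx = 0\<close>\<close>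
    have "e \<otimes> x = \<zero>" if x: "x \<in> carrier R" "m \<otimes> x = \<zero>" for x
    proof -
      have "m \<otimes> (e \<otimes> x) = \<zero>" using m_assoc[OF mR eR x(1)] e(2) x by simp
      then have "e \<otimes> x \<in> right_annihilator R m \<inter> L"
        using LD(4)[OF e(1) x(1)] eR x by (auto simp: right_annihilator_def)
      then show ?thesis using int by blast
    qed
    then have "annihilator_splitting R m e" using mR eR e(2) by (auto simp: annihilator_splitting_def)
    moreover have "m \<noteq> \<zero>" using my y(1) LD(1) by auto
    ultimately show ?thesis using m by blast
  next
    case False
    have "singular_rmodule R ((regular_rmodule R)\<lparr>carrier := T\<rparr>)"
      unfolding singular_rmodule_def
    proof (intro conjI ballI)
      fix m assume "m \<in> carrier ((regular_rmodule R)\<lparr>carrier := T\<rparr>)"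
      then have m: "m \<in> T" "m \<in> carrier R" using TD(1) by auto
      have "annihilator R ((regular_rmodule R)\<lparr>carrier := T\<rparr>) m = right_annihilator R m"
        by (simp add: annihilator_def right_annihilator_def)
      moreover have "right_ideal R (right_annihilator R m)"
        by (rule Reg.rsubmoduleI)
           (use m in \<open>auto simp: right_annihilator_def r_distr m_assoc[symmetric]\<close>)
      ultimately show "essential_submodule R (regular_rmodule R)
          (annihilator R ((regular_rmodule R)\<lparr>carrier := T\<rparr>) m)"
        using False m by (auto simp: essential_submodule_def)
    qed (rule Reg.rsubmodule_is_right_module[OF T(1)])
    then have inj: "ss_injective R ((regular_rmodule R)\<lparr>carrier := T\<rparr>)"
      using simple_singular_ss_injective_any_type[OF all T(2)] by blast
    obtain e where e: "e \<in> T" "\<And>x. x \<in> T \<Longrightarrow> e \<otimes> x = x"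
      using non_small_left_identity[OF T] ss_injective_left_identity[OF T _ inj] by blast
    obtain m where m: "m \<in> T" "m \<noteq> \<zero>" using Reg.simple_rsubmodule_nonzero[OF T] by auto
    have "e \<noteq> \<zero>" using e(2)[OF m(1)] m TD(1) by auto
    moreover have "annihilator_splitting R e e" using e TD(1) by (auto simp: annihilator_splitting_def)
    ultimately show ?thesis using e(1) by blast
  qed
  then obtain m e where m: "m \<in> T" "m \<noteq> \<zero>" and spl: "annihilator_splitting R m e" by blast
  have "m \<otimes> \<one> \<noteq> \<zero>" using m TD(1) by auto
  then have "(\<otimes>) m ` carrier R = T"
    using simple_right_ideal_principal[OF T Reg.rsubmodule_carrier, of m \<one>] m by simp
  then show ?thesis using spl by blast
qed

section \<open>The right socle\<close>

lemma right_ideal_right_socle: "right_ideal R (right_socle R)"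
  unfolding right_socle_def by (rule Reg.rsubmodule_socle)

text \<open>
  The constraint \<open>g y = f x\<close> is imposed together with \<open>x \<in> right_socle R\<close>, because \<open>f\<close> is additive only
  there; the extension starts from the zero submodule.
\<close>

lemma right_socle_projective:
  assumes "\<And>T. \<lbrakk>right_ideal R T; simple_rmodule R ((regular_rmodule R)\<lparr>carrier := T\<rparr>)\<rbrakk> \<Longrightarrow>
      \<exists>m e. T = (\<otimes>) m ` carrier R \<and> annihilator_splitting R m e"
  shows "projective_rmodule TYPE('m) TYPE('n) R ((regular_rmodule R)\<lparr>carrier := right_socle R\<rparr>)"
  unfolding projective_rmodule_def
proof (intro conjI allI impI ballI, goal_cases)
  case 1
  show ?case by (rule Reg.rsubmodule_is_right_module[OF right_ideal_right_socle])
next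
  case (2 A B g f)
  then interpret A: right_module R A by simp
  from 2 interpret B: right_module R B by simp
  let ?S = "right_socle R" and ?Z = "(regular_rmodule R)\<lparr>carrier := {\<zero>}\<rparr>"
  note gD = rmodule_homD[OF 2(2)] and fD = rmodule_homD[OF 2(4), simplified]
  note SD = rsubmoduleD[OF right_ideal_right_socle, simplified]
  have g0: "g \<zero>\<^bsub>A\<^esub> = \<zero>\<^bsub>B\<^esub>"
    using gD(3)[of "\<zero>\<^bsub>A\<^esub>" \<zero>] gD(1)[of "\<zero>\<^bsub>A\<^esub>"] by (simp add: A.ract_zero B.ract_zero)
  have f0: "f \<zero> = \<zero>\<^bsub>B\<^esub>"
    using fD(3)[OF SD(2), of \<zero>] fD(1)[OF SD(2)] by (simp add: B.ract_zero)
  have "\<exists>h\<in>rmodule_hom R ((regular_rmodule R)\<lparr>carrier := socle R (regular_rmodule R)\<rparr>) A.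
      (\<forall>x\<in>socle R (regular_rmodule R). x \<in> ?S \<and> g (h x) = f x) \<and>
      (\<forall>x\<in>{\<zero>} \<inter> socle R (regular_rmodule R). h x = (\<lambda>_. \<zero>\<^bsub>A\<^esub>) x)"
  proof (rule Reg.extend_hom_to_socle[OF A.right_module_axioms])
    show "right_ideal R {\<zero>}" using Reg.rsubmodule_zero by simp
    show "(\<lambda>_. \<zero>\<^bsub>A\<^esub>) \<in> rmodule_hom R ?Z A" by (rule rmodule_homI) (auto simp: A.zero_ract)
    show "x \<in> ?S \<and> g \<zero>\<^bsub>A\<^esub> = f x" if "x \<in> {\<zero>}" for x using that g0 f0 SD(2) by simp
  next
    fix x y x' y'
    assume "y \<in> carrier A" "y' \<in> carrier A" "x \<in> ?S \<and> g y = f x" "x' \<in> ?S \<and> g y' = f x'"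
    then show "x \<oplus>\<^bsub>regular_rmodule R\<^esub> x' \<in> ?S \<and> g (y \<oplus>\<^bsub>A\<^esub> y') = f (x \<oplus>\<^bsub>regular_rmodule R\<^esub> x')"
      using gD(2) fD(2) SD(3) by simp
  next
    fix T assume T: "right_ideal R T" "simple_rmodule R ((regular_rmodule R)\<lparr>carrier := T\<rparr>)"
    have TS: "T \<subseteq> ?S" unfolding right_socle_def by (rule Reg.simple_subset_socle[OF T])
    then have fT: "f \<in> rmodule_hom R ((regular_rmodule R)\<lparr>carrier := T\<rparr>) B"
      using fD by (intro rmodule_homI) (auto simp: subset_iff)
    obtain m e where T_eq: "T = (\<otimes>) m ` carrier R" and spl: "annihilator_splitting R m e"
      using assms[OF T] by blast
    show "\<exists>h\<in>rmodule_hom R ((regular_rmodule R)\<lparr>carrier := T\<rparr>) A. \<forall>x\<in>T. x \<in> ?S \<and> g (h x) = f x"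
      using lift_from_splitting[OF spl A.right_module_axioms B.right_module_axioms 2(2,3)
        fT[unfolded T_eq]] TS unfolding T_eq by blast
  qed
  then show ?case unfolding right_socle_def by auto
qed

text \<open>
  Submodules of semisimple modules are direct summands. Here this is an extension problem without
  a constraint: the identity map of \<open>I\<close> extends to the socle, the zero map serving on each simple
  submodule.
\<close>

lemma right_socle_retraction:
  assumes I: "right_ideal R I" and "I \<subseteq> right_socle R"
  obtains p where
    "p \<in> rmodule_hom R ((regular_rmodule R)\<lparr>carrier := right_socle R\<rparr>)
       ((regular_rmodule R)\<lparr>carrier := I\<rparr>)"
    and "\<And>x. x \<in> I \<Longrightarrow> p x = x"
proof -
  interpret I: right_module R "(regular_rmodule R)\<lparr>carrier := I\<rparr>"
    by (rule Reg.rsubmodule_is_right_module[OF I])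
  have "\<exists>p\<in>rmodule_hom R ((regular_rmodule R)\<lparr>carrier := socle R (regular_rmodule R)\<rparr>)
        ((regular_rmodule R)\<lparr>carrier := I\<rparr>).
      (\<forall>x\<in>socle R (regular_rmodule R). True) \<and> (\<forall>x\<in>I \<inter> socle R (regular_rmodule R). p x = id x)"
  proof (rule Reg.extend_hom_to_socle[OF I.right_module_axioms I])
    show "id \<in> rmodule_hom R ((regular_rmodule R)\<lparr>carrier := I\<rparr>) ((regular_rmodule R)\<lparr>carrier := I\<rparr>)"
      by (rule rmodule_homI) auto
    fix T assume "right_ideal R T"
    have "(\<lambda>_. \<zero>) \<in> rmodule_hom R ((regular_rmodule R)\<lparr>carrier := T\<rparr>) ((regular_rmodule R)\<lparr>carrier := I\<rparr>)"
      by (rule rmodule_homI) (use rsubmoduleD(2)[OF I] in auto)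
    then show "\<exists>h\<in>rmodule_hom R ((regular_rmodule R)\<lparr>carrier := T\<rparr>) ((regular_rmodule R)\<lparr>carrier := I\<rparr>).
      \<forall>x\<in>T. True" by blast
  qed auto
  then show thesis using that assms(2) unfolding right_socle_def by auto
qed

text \<open>
  The retraction \<open>p\<close> of the socle onto \<open>aR\<close> lifts along \<open>R \<rightarrow> aR\<close> to a homomorphism \<open>h\<close>, and
  \<open>ax \<mapsto> h(ax)\<close> is the splitting, so that \<open>e = h(a)\<close>.
\<close>

lemma splitting_of_projective_right_socle:
  assumes proj: "projective_rmodule TYPE('a) TYPE('a) R
      ((regular_rmodule R)\<lparr>carrier := right_socle R\<rparr>)"
    and a: "a \<in> right_socle R"
  shows "\<exists>e. annihilator_splitting R a e"
proof -
  let ?S = "(regular_rmodule R)\<lparr>carrier := right_socle R\<rparr>"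
  let ?I = "(\<otimes>) a ` carrier R"
  let ?aR = "(regular_rmodule R)\<lparr>carrier := ?I\<rparr>"
  note SD = rsubmoduleD[OF right_ideal_right_socle, simplified]
  have aR: "a \<in> carrier R" using a SD(1) by blast
  have aI: "a \<in> ?I" using aR r_one[of a] one_closed by (metis image_eqI)
  note I = right_ideal_principal[OF aR]
  obtain p where p: "p \<in> rmodule_hom R ?S ?aR" and pid: "\<And>x. x \<in> ?I \<Longrightarrow> p x = x"
    using right_socle_retraction[OF I] SD(4)[OF a] by blast
  have "(\<otimes>) a \<in> rmodule_hom R (regular_rmodule R) ?aR"
    by (rule rmodule_homI) (use aR in \<open>auto simp: r_distr m_assoc\<close>)
  moreover have "(\<otimes>) a ` carrier (regular_rmodule R) = carrier ?aR" by simp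
  ultimately obtain h where h: "h \<in> rmodule_hom R ?S (regular_rmodule R)"
    and ah: "\<forall>x\<in>carrier ?S. a \<otimes> h x = p x"
    using proj p regular_right_module Reg.rsubmodule_is_right_module[OF I]
    unfolding projective_rmodule_def by blast
  note hD = rmodule_homD[OF h, simplified]
  have h0: "h \<zero> = \<zero>" using hD(3)[OF SD(2), of \<zero>] hD(1)[OF SD(2)] by simp
  have "a \<otimes> h a = a" using ah a pid[OF aI] by simp
  moreover have "h a \<otimes> x = \<zero>" if "x \<in> carrier R" "a \<otimes> x = \<zero>" for x
    using hD(3)[OF a that(1)] that(2) h0 by simp
  ultimately show ?thesis using aR hD(1)[OF a] by (auto simp: annihilator_splitting_def)
qed

end

theorem theorem2p20:
  fixes R :: "('a, 'b) ring_scheme" (structure)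
  assumes "ring R"
    and "\<And>M :: ('a, 'a set) rmodule.
      simple_rmodule R M \<Longrightarrow> singular_rmodule R M \<Longrightarrow> ss_injective R M"
  shows "(\<forall>a \<in> right_socle R \<inter> jacobson_radical R.
           direct_summand R (regular_rmodule R) (right_annihilator R a)) \<and>
         projective_rmodule TYPE('m) TYPE('n) R ((regular_rmodule R)\<lparr>carrier := right_socle R\<rparr>)"
proof -
  interpret ring R by (rule assms(1))
  note splitting = simple_right_ideal_splitting[OF assms(2)]
  \<comment> \<open>lifting against \<open>R \<rightarrow> aR\<close>, whose modules consist of ring elements\<close>
  have "projective_rmodule TYPE('a) TYPE('a) R ((regular_rmodule R)\<lparr>carrier := right_socle R\<rparr>)"
    by (rule right_socle_projective[OF splitting])
  then have "direct_summand R (regular_rmodule R) (right_annihilator R a)" if "a \<in> right_socle R" for a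
    using splitting_of_projective_right_socle[OF _ that] right_annihilator_direct_summand by blast
  then show ?thesis using right_socle_projective[OF splitting] by blast
qed

end
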